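(* Let $n\ge 1$ and let $\varphi:M_2(\mathbb{C})\to M_{n+1}(\mathbb{C})$ be a positive linear map whose Choi matrix $\mathbf{H}_\varphi=[\varphi(E_{ij})]_{i,j=1}^2$ has the form $$\mathbf{H}_\varphi=\left[\begin{array}{cc|cc} a&C&x&Y \\ C^*&B&Z^*&T \\ \hline \overline{x}&Z&0&0 \\ Y^*&T^*&0&U\end{array}\right],$$ where $a,x\in\mathbb{C}$, $C,Y,Z\in M_{1,n}(\mathbb{C})$ and $B,T,U\in M_n(\mathbb{C})$. Then $$|Y|+|Z|\leq a^{1/2}U^{1/2}.$$
   Context: "Positive matrix" means positive semidefinite, and $\le$ is the corresponding (Loewner) order on Hermitian matrices. A linear map $\varphi:M_m(\mathbb{C})\to M_k(\mathbb{C})$ is positive if $\varphi(A)$ is positive for every positive $A\in M_m(\mathbb{C})$. $\{E_{ij}\}_{i,j=1}^2$ denotes the standard matrix units of $M_2(\mathbb{C})$. The Choi matrix of a linear map $\varphi:M_2(\mathbb{C})\to M_{n+1}(\mathbb{C})$ is $\mathbf{H}_\varphi=[\varphi(E_{ij})]_{i,j=1}^2\in M_2(M_{n+1}(\mathbb{C}))$. Each of its four blocks, separated by lines in the display, is an $(n+1)\times(n+1)$ matrix written with respect to the splitting $\mathbb{C}^{n+1}=\mathbb{C}\oplus\mathbb{C}^n$ (first standard basis vector, then the remaining $n$). So, for instance, $\varphi(E_{11})=\begin{bmatrix}a&C\\ C^*&B\end{bmatrix}$, $\varphi(E_{12})=\begin{bmatrix}x&Y\\ Z^*&T\end{bmatrix}$,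 $\varphi(E_{21})=\begin{bmatrix}\overline{x}&Z\\ Y^*&T^*\end{bmatrix}$ and $\varphi(E_{22})=\begin{bmatrix}0&0\\ 0&U\end{bmatrix}$, where $0$ stands for a zero scalar, row or column of the appropriate size. Positivity of $\varphi$ forces $\varphi(E_{11})$ and $\varphi(E_{22})$ to be positive, so $a\ge 0$ and $U\ge 0$, and $a^{1/2}$, $U^{1/2}$ denote the positive square roots. For a row $X\in M_{1,n}(\mathbb{C})$, $|X|$ denotes the $n\times n$ positive matrix $(X^*X)^{1/2}$. *)

theory Defs
  imports "Jordan_Normal_Form.Schur_Decomposition"
begin

definition hermitian_mat :: "complex mat \<Rightarrow> bool" where
  "hermitian_mat A \<longleftrightarrow> mat_adjoint A = A"

(* The order on complex is that of HOL-Library.Complex_Order: 0 \<le> z says that z is real and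
   nonnegative. *)
definition psd_mat :: "nat \<Rightarrow> complex mat \<Rightarrow> bool" where
  "psd_mat n A \<longleftrightarrow> A \<in> carrier_mat n n \<and> hermitian_mat A \<and>
     (\<forall>v\<in>carrier_vec n. 0 \<le> (A *\<^sub>v v) \<bullet>c v)"

definition loewner_le :: "nat \<Rightarrow> complex mat \<Rightarrow> complex mat \<Rightarrow> bool" where
  "loewner_le n A B \<longleftrightarrow> A \<in> carrier_mat n n \<and> B \<in> carrier_mat n n \<and>
     hermitian_mat A \<and> hermitian_mat B \<and> psd_mat n (B - A)"

(* Meaningful for positive semidefinite A, where the positive square root exists and is unique. *)
definition psd_sqrt :: "complex mat \<Rightarrow> complex mat" where
  "psd_sqrt A = (THE S. psd_mat (dim_row A) S \<and> S * S = A)"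

definition mat_abs :: "complex mat \<Rightarrow> complex mat" where
  "mat_abs X = psd_sqrt (mat_adjoint X * X)"

(* Indices start at 0, so the mathematical E_11, ..., E_22 are matrix_unit 2 0 0, ...,
   matrix_unit 2 1 1. *)
definition matrix_unit :: "nat \<Rightarrow> nat \<Rightarrow> nat \<Rightarrow> complex mat" where
  "matrix_unit m i j = mat m m (\<lambda>(k, l). if k = i \<and> l = j then 1 else 0)"

definition linear_mat_map :: "nat \<Rightarrow> nat \<Rightarrow> (complex mat \<Rightarrow> complex mat) \<Rightarrow> bool" where
  "linear_mat_map m k \<phi> \<longleftrightarrow>
     (\<forall>A\<in>carrier_mat m m. \<phi> A \<in> carrier_mat k k) \<and>
     (\<forall>A\<in>carrier_mat m m. \<forall>B\<in>carrier_mat m m. \<phi> (A + B) = \<phi> A + \<phi> B) \<and>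
     (\<forall>c. \<forall>A\<in>carrier_mat m m. \<phi> (c \<cdot>\<^sub>m A) = c \<cdot>\<^sub>m \<phi> A)"

definition positive_mat_map :: "nat \<Rightarrow> nat \<Rightarrow> (complex mat \<Rightarrow> complex mat) \<Rightarrow> bool" where
  "positive_mat_map m k \<phi> \<longleftrightarrow> (\<forall>A. psd_mat m A \<longrightarrow> psd_mat k (\<phi> A))"

(* For maps with domain M_2 only; the element of M_2(M_k) is flattened to a 2k x 2k matrix. *)
definition choi_matrix :: "(complex mat \<Rightarrow> complex mat) \<Rightarrow> complex mat" where
  "choi_matrix \<phi> = four_block_mat
     (\<phi> (matrix_unit 2 0 0)) (\<phi> (matrix_unit 2 0 1))
     (\<phi> (matrix_unit 2 1 0)) (\<phi> (matrix_unit 2 1 1))"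

definition scalar_mat :: "complex \<Rightarrow> complex mat" where
  "scalar_mat c = mat 1 1 (\<lambda>_. c)"

end

theory Submission
  imports Defs "Jordan_Normal_Form.Spectral_Radius" "HOL-Analysis.L2_Norm"
begin

text \<open>
  Evaluating \<open>\<phi>\<close> on the rank one matrices \<open>[[1, cnj q], [q, |q|^2]]\<close> and letting \<open>|q|\<close> tend to
  infinity with the first coordinate of the test vector scaled by \<open>|q|\<close>, one gets \<open>x = 0\<close> and
  \<open>|(cnj w Y + w Z) v|^2 \<le> a \<langle>U v, v\<rangle>\<close> for every phase \<open>w\<close>.  The best phase turns this into
  \<open>(|Y v| + |Z v|)^2 \<le> a \<langle>U v, v\<rangle>\<close>.  Since \<open>|Y v|\<close> is the length of \<open>|Y| v\<close>, the triangle
  inequality gives \<open>(|Y| + |Z|)^2 \<le> a U\<close>, and the square root is operator monotone.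
\<close>

section \<open>Adjoints\<close>

text \<open>The zero corner of \<open>\<phi> (matrix_unit 2 1 1)\<close> shapes the argument: it
  removes the term |q|^2 |s|^2, so nothing of degree four can absorb the cubic term carrying x, and
  once x = 0 the cross terms with Y and Z have the same degree as a |s|^2 and u |q|^2, where u is
  the value of the form of U at v. Y comes with cnj q and Z with q, so a phase of q turns Y v and Z
  v in opposite directions. This is enough to align any two complex numbers, which is why their
  moduli may be added. The phase depends on v, which is harmless because the inequality is only
  needed at each single v. Uniqueness of the positive root, on which \<open>psd_sqrt\<close> rests,
  comes from the same monotonicity of the root, applied in both directions; two roots are never
  diagonalised simultaneously.\<close>

lemma mat_adjoint_dim [simp]:
  "dim_row (mat_adjoint A) = dim_col A" "dim_col (mat_adjoint A) = dim_row A"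
  by (simp_all add: mat_adjoint_def)

lemma mat_adjoint_carrier [simp]:
  "A \<in> carrier_mat m n \<Longrightarrow> mat_adjoint A \<in> carrier_mat n m"
  by auto

lemma mat_adjoint_index [simp]:
  "i < dim_col A \<Longrightarrow> j < dim_row A \<Longrightarrow> mat_adjoint A $$ (i, j) = conjugate (A $$ (j, i))"
  by (simp add: mat_adjoint_def mat_of_rows_index)

lemma mat_adjoint_mat_adjoint [simp]: "mat_adjoint (mat_adjoint A) = A"
  by (rule eq_matI) auto

lemma mat_adjoint_one [simp]:
  "mat_adjoint (1\<^sub>m n :: 'a::conjugatable_field mat) = 1\<^sub>m n"
proof -
  \<comment> \<open>The conjugate of 1 * \<open>conjugate 1\<close> is 1 by involutivity alone, and
    \<open>conjugate 1\<close> when multiplicativity is used first.\<close>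
  have "conjugate (1::'a) = 1"
    using conjugate_dist_mul[of "1::'a" "conjugate 1"] by simp
  then show ?thesis
    by (intro eq_matI) (auto simp: one_mat_def)
qed

lemma mat_adjoint_mult:
  fixes A :: "'a::conjugatable_field mat"
  assumes "A \<in> carrier_mat m n" "B \<in> carrier_mat n k"
  shows "mat_adjoint (A * B) = mat_adjoint B * mat_adjoint A"
  using assms
  by (intro eq_matI) (auto simp: scalar_prod_def sum_conjugate conjugate_dist_mul mult.commute)

lemma mat_adjoint_add:
  fixes A :: "'a::conjugatable_field mat"
  assumes "A \<in> carrier_mat m n" "B \<in> carrier_mat m n"
  shows "mat_adjoint (A + B) = mat_adjoint A + mat_adjoint B"
  using assms by (intro eq_matI) (auto simp: conjugate_dist_add)

lemma mat_adjoint_minus: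
  fixes A :: "'a::conjugatable_field mat"
  assumes "A \<in> carrier_mat m n" "B \<in> carrier_mat m n"
  shows "mat_adjoint (A - B) = mat_adjoint A - mat_adjoint B"
proof -
  have "conjugate (a - b) = conjugate a - conjugate b" for a b :: 'a
    using conjugate_dist_add[of a "- b"] by (simp add: conjugate_neg)
  then show ?thesis
    using assms by (intro eq_matI) auto
qed

lemma mat_adjoint_smult:
  fixes A :: "'a::conjugatable_field mat"
  shows "mat_adjoint (c \<cdot>\<^sub>m A) = conjugate c \<cdot>\<^sub>m mat_adjoint A"
  by (intro eq_matI) (auto simp: conjugate_dist_mul)

lemma cscalar_prod_mat_adjoint:
  fixes A :: "'a::conjugatable_field mat"
  assumes A: "A \<in> carrier_mat m n" and v: "v \<in> carrier_vec n" and w: "w \<in> carrier_vec m"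
  shows "(A *\<^sub>v v) \<bullet>c w = v \<bullet>c (mat_adjoint A *\<^sub>v w)"
proof -
  have "(A *\<^sub>v v) \<bullet>c w = (\<Sum>i = 0..<m. \<Sum>j = 0..<n. A $$ (i, j) * v $ j * conjugate (w $ i))"
    using assms by (auto simp: scalar_prod_def sum_distrib_right intro!: sum.cong)
  also have "\<dots> = (\<Sum>j = 0..<n. \<Sum>i = 0..<m. A $$ (i, j) * v $ j * conjugate (w $ i))"
    by (rule sum.swap)
  also have "\<dots> = v \<bullet>c (mat_adjoint A *\<^sub>v w)"
    using assms
    by (auto simp: scalar_prod_def sum_distrib_left sum_conjugate conjugate_dist_mul mult_ac
        intro!: sum.cong)
  finally show ?thesis .
qed

lemma cscalar_prod_left_add:
  fixes u v w :: "'a::conjugatable_ring vec"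
  assumes "u \<in> carrier_vec n" "v \<in> carrier_vec n" "w \<in> carrier_vec n"
  shows "(u + v) \<bullet>c w = u \<bullet>c w + v \<bullet>c w"
  using assms by (simp add: add_scalar_prod_distrib)

lemma mat_adjoint_four_block_diag:
  fixes A :: "'a::conjugatable_field mat"
  assumes "A \<in> carrier_mat n n" "B \<in> carrier_mat m m"
  shows "mat_adjoint (four_block_mat A (0\<^sub>m n m) (0\<^sub>m m n) B)
    = four_block_mat (mat_adjoint A) (0\<^sub>m n m) (0\<^sub>m m n) (mat_adjoint B)"
  using assms by (intro eq_matI) auto

section \<open>The spectral theorem\<close>

text \<open>\<open>corthogonal_mat\<close> says that the columns are nonzero and mutually
  orthogonal. Dividing each by its length gives a unitary matrix and keeps every column direction,
  which is what matters for an eigenvector placed in a column.\<close>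

lemma corthogonal_mat_normalise:
  fixes W :: "complex mat"
  assumes W: "W \<in> carrier_mat n n" and orth: "corthogonal_mat W"
  obtains V where "V \<in> carrier_mat n n" "mat_adjoint V * V = 1\<^sub>m n"
    "\<And>j. j < n \<Longrightarrow> \<exists>c. col V j = c \<cdot>\<^sub>v col W j"
proof -
  define r where "r j = complex_of_real (1 / sqrt (Re (col W j \<bullet>c col W j)))" for j
  define V where "V = mat n n (\<lambda>(i, j). r j * W $$ (i, j))"
  have V: "V \<in> carrier_mat n n"
    by (simp add: V_def)
  have colV: "col V j = r j \<cdot>\<^sub>v col W j" if "j < n" for j
    using that W by (intro eq_vecI) (auto simp: V_def)
  have cW [simp]: "col W j \<in> carrier_vec n" for j
    using W by auto
  have "mat_adjoint V * V = 1\<^sub>m n"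
  proof (rule eq_matI)
    fix i j assume "i < dim_row (1\<^sub>m n :: complex mat)" "j < dim_col (1\<^sub>m n :: complex mat)"
    then have i: "i < n" and j: "j < n" by auto
    have "(mat_adjoint V * V) $$ (i, j) = col V j \<bullet>c col V i"
      using V i j by (auto simp: scalar_prod_def intro!: sum.cong)
    also have "\<dots> = r j * cnj (r i) * (col W j \<bullet>c col W i)"
      using cW[of i] cW[of j] by (simp add: colV i j conjugate_smult_vec)
    also have "\<dots> = (1\<^sub>m n) $$ (i, j)"
    proof (cases "i = j")
      case True
      have nz: "col W j \<bullet>c col W j \<noteq> 0"
        using corthogonal_matD[OF orth, of j j] j W by auto
      have ge: "col W j \<bullet>c col W j \<ge> 0"
        by (rule conjugate_square_ge_0_vec)
      define x where "x = Re (col W j \<bullet>c col W j)"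
      have eq: "col W j \<bullet>c col W j = complex_of_real x"
        using ge by (simp add: x_def less_eq_complex_def complex_eq_iff)
      have "x > 0"
        using ge nz unfolding eq by (simp add: less_eq_complex_def)
      then have s: "(1 / sqrt x) * (1 / sqrt x) * x = 1"
        by (simp add: field_simps)
      have rj: "r j = complex_of_real (1 / sqrt x)"
        by (simp only: r_def x_def)
      have "r j * cnj (r j) * complex_of_real x = 1"
        unfolding rj complex_cnj_complex_of_real of_real_mult[symmetric] s by simp
      then show ?thesis
        using True i j by (simp add: eq)
    next
      case False
      then have "col W j \<bullet>c col W i = 0"
        using corthogonal_matD[OF orth, of j i] i j W by auto
      then show ?thesis
        using False i j by simp
    qed
    finally show "(mat_adjoint V * V) $$ (i, j) = (1\<^sub>m n) $$ (i, j)" .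
  qed (use V in auto)
  then show ?thesis
    by (rule that[OF V]) (use colV in blast)
qed

text \<open>Gram-Schmidt applied to a basis that starts with v leaves v in place, and normalising
  only rescales it.\<close>

lemma unitary_first_col:
  fixes v :: "complex vec"
  assumes v: "v \<in> carrier_vec n" and v0: "v \<noteq> 0\<^sub>v n"
  obtains V c where "V \<in> carrier_mat n n" "mat_adjoint V * V = 1\<^sub>m n" "col V 0 = c \<cdot>\<^sub>v v"
proof -
  interpret cof_vec_space n "TYPE(complex)" .
  define b where "b = basis_completion v"
  define ws where "ws = gram_schmidt n b"
  have n: "n \<noteq> 0"
    using v v0 by (auto intro!: eq_vecI)
  note b = basis_completion[OF v v0, folded b_def]
  then obtain vs where bv: "b = v # vs"
    using n by (cases b) simp_all
  have ws: "set ws \<subseteq> carrier_vec n" "corthogonal ws" "length ws = n"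
    using gram_schmidt_result[OF b(2,4,5) refl, folded ws_def] b(6) by auto
  have hdws: "hd ws = v"
    using gram_schmidt_hd[OF v, of vs] by (simp add: ws_def bv)
  have W: "mat_of_cols n ws \<in> carrier_mat n n"
    using mat_of_cols_carrier(1)[of n ws] ws by simp
  have "col (mat_of_cols n ws) 0 = v"
    using ws n hdws by (cases ws) auto
  moreover obtain V where V: "V \<in> carrier_mat n n" "mat_adjoint V * V = 1\<^sub>m n"
    and colV: "\<And>j. j < n \<Longrightarrow> \<exists>c. col V j = c \<cdot>\<^sub>v col (mat_of_cols n ws) j"
    using corthogonal_mat_normalise[OF W orthogonal_mat_of_cols[OF ws]] by metis
  moreover obtain c where "col V 0 = c \<cdot>\<^sub>v col (mat_of_cols n ws) 0"
    using colV[of 0] n by blast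
  ultimately show ?thesis
    using that by simp
qed

lemma unitary_inverse:
  fixes V :: "complex mat"
  assumes "V \<in> carrier_mat n n" "mat_adjoint V * V = 1\<^sub>m n"
  shows "V * mat_adjoint V = 1\<^sub>m n"
  using assms by (metis mat_adjoint_carrier mat_mult_left_right_inverse)

text \<open>Deflation: in a unitary basis that starts with an eigenvector, the first column of the
  matrix is e times the first unit vector. Being hermitian, the matrix has a vanishing rest of the
  first row as well, so it splits into e and a smaller hermitian block. That D is real or
  nonnegative is not claimed here; it is recovered where needed by conjugating back.\<close>

theorem hermitian_spectral:
  assumes "A \<in> carrier_mat n n" "hermitian_mat A"
  shows "\<exists>P D. P \<in> carrier_mat n n \<and> D \<in> carrier_mat n n \<and> mat_adjoint P * P = 1\<^sub>m n \<and>
    diagonal_mat D \<and> A = P * D * mat_adjoint P"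
  using assms
proof (induction n arbitrary: A)
  case 0
  then show ?case
    by (intro exI[of _ "1\<^sub>m 0"]) (auto simp: diagonal_mat_def intro!: eq_matI)
next
  case (Suc n)
  note A = Suc.prems(1)
  obtain e v where "eigenvector A v e"
    using spectrum_non_empty[OF A] by (auto simp: spectrum_def eigenvalue_def)
  then have v: "v \<in> carrier_vec (Suc n)" "v \<noteq> 0\<^sub>v (Suc n)" "A *\<^sub>v v = e \<cdot>\<^sub>v v"
    using A by (auto simp: eigenvector_def)
  obtain V c where V: "V \<in> carrier_mat (Suc n) (Suc n)" and VV: "mat_adjoint V * V = 1\<^sub>m (Suc n)"
    and V0: "col V 0 = c \<cdot>\<^sub>v v"
    using unitary_first_col[OF v(1,2)] by blast
  have VV': "V * mat_adjoint V = 1\<^sub>m (Suc n)"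
    using unitary_inverse[OF V VV] .
  define M where "M = mat_adjoint V * A * V"
  have M: "M \<in> carrier_mat (Suc n) (Suc n)"
    using A V by (auto simp: M_def)
  have adjM: "mat_adjoint M = M"
  proof -
    have "mat_adjoint M = mat_adjoint V * mat_adjoint (mat_adjoint V * A)"
      unfolding M_def using A V by (intro mat_adjoint_mult) auto
    also have "mat_adjoint (mat_adjoint V * A) = mat_adjoint A * V"
      using A V by (subst mat_adjoint_mult) auto
    finally show ?thesis
      using A V Suc.prems(2) unfolding M_def hermitian_mat_def
      by (metis assoc_mult_mat mat_adjoint_carrier)
  qed
  have AV: "A = V * M * mat_adjoint V"
  proof -
    have "V * M * mat_adjoint V = V * (M * mat_adjoint V)"
      using V M by (intro assoc_mult_mat) auto
    also have "M * mat_adjoint V = mat_adjoint V * A * (V * mat_adjoint V)"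
      unfolding M_def using V A by (intro assoc_mult_mat) auto
    also have "\<dots> = mat_adjoint V * A"
      using V A VV' by simp
    also have "V * (mat_adjoint V * A) = V * mat_adjoint V * A"
      using V A by (intro assoc_mult_mat[symmetric]) auto
    also have "\<dots> = A"
      using V A VV' by simp
    finally show ?thesis by simp
  qed
  have cV0: "col V 0 \<in> carrier_vec (Suc n)"
    using V by (metis carrier_matD(1) col_dim)
  \<comment> \<open>The first column of \<open>V\<close> is a multiple of \<open>v\<close>, so
    \<open>A\<close> scales it by \<open>e\<close>, and \<open>mat_adjoint V\<close> sends it to the
    first unit vector.\<close>
  have col0: "col M 0 = e \<cdot>\<^sub>v unit_vec (Suc n) 0"
  proof -
    have "col M 0 = mat_adjoint V *\<^sub>v (A *\<^sub>v col V 0)"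
    proof -
      have "col M 0 = mat_adjoint V * A *\<^sub>v col V 0"
        unfolding M_def using V A by (intro col_mult2[of _ "Suc n" "Suc n" _ "Suc n"]) auto
      also have "\<dots> = mat_adjoint V *\<^sub>v (A *\<^sub>v col V 0)"
        using V A cV0 by (intro assoc_mult_mat_vec[of _ "Suc n" "Suc n" _ "Suc n"]) auto
      finally show ?thesis .
    qed
    also have "A *\<^sub>v col V 0 = e \<cdot>\<^sub>v col V 0"
      unfolding V0 mult_mat_vec[OF A v(1)] v(3) smult_smult_assoc mult.commute[of c e] ..
    also have "mat_adjoint V *\<^sub>v (e \<cdot>\<^sub>v col V 0) = e \<cdot>\<^sub>v (mat_adjoint V *\<^sub>v col V 0)"
      using V cV0 by (intro mult_mat_vec[of _ "Suc n" "Suc n"]) auto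
    also have "mat_adjoint V *\<^sub>v col V 0 = col (mat_adjoint V * V) 0"
      using V by (intro col_mult2[symmetric, of _ "Suc n" "Suc n" _ "Suc n"]) auto
    finally show ?thesis by (simp add: VV)
  qed
  have Mi0: "M $$ (i, 0) = 0" if "0 < i" "i < Suc n" for i
    using arg_cong[OF col0, of "\<lambda>w. w $ i"] that M by auto
  have M00: "M $$ (0, 0) = e"
    using arg_cong[OF col0, of "\<lambda>w. w $ 0"] M by auto
  have Madj: "M $$ (i, j) = cnj (M $$ (j, i))" if "i < Suc n" "j < Suc n" for i j
    using arg_cong[OF adjM, of "\<lambda>X. X $$ (i, j)"] that M by auto
  have M0i: "M $$ (0, i) = 0" if "0 < i" "i < Suc n" for i
    using Madj[of 0 i] Mi0[of i] that by simp
  define A' where "A' = mat n n (\<lambda>(i, j). M $$ (Suc i, Suc j))"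
  have A': "A' \<in> carrier_mat n n" by (simp add: A'_def)
  have hA': "hermitian_mat A'"
    unfolding hermitian_mat_def A'_def by (intro eq_matI) (auto simp flip: Madj)
  let ?E = "mat 1 1 (\<lambda>_. e)"
  let ?fb = "\<lambda>X Y. four_block_mat X (0\<^sub>m 1 n) (0\<^sub>m n 1) Y"
  have M_block: "M = ?fb ?E A'"
    using M M00 Mi0 M0i by (intro eq_matI) (auto simp: A'_def)
  obtain P' D' where P': "P' \<in> carrier_mat n n" and D': "D' \<in> carrier_mat n n"
    and PP': "mat_adjoint P' * P' = 1\<^sub>m n" and diag: "diagonal_mat D'"
    and A'eq: "A' = P' * D' * mat_adjoint P'"
    using Suc.IH[OF A' hA'] by blast
  \<comment> \<open>The diagonalising matrix of the smaller block, extended so that it fixes the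
    eigenvector already split off.\<close>
  define Q where "Q = ?fb (1\<^sub>m 1) P'"
  define D where "D = ?fb ?E D'"
  have Q: "Q \<in> carrier_mat (Suc n) (Suc n)" and D: "D \<in> carrier_mat (Suc n) (Suc n)"
    using P' D' unfolding Q_def D_def
    by (metis four_block_carrier_mat mat_carrier one_carrier_mat plus_1_eq_Suc)+
  have adjQ: "mat_adjoint Q = ?fb (1\<^sub>m 1) (mat_adjoint P')"
    unfolding Q_def using P' by (subst mat_adjoint_four_block_diag) auto
  have E: "?E \<in> carrier_mat 1 1" by simp
  have fb_mult: "?fb X Y * ?fb X' Y' = ?fb (X * X') (Y * Y')"
    if "X \<in> carrier_mat 1 1" "X' \<in> carrier_mat 1 1" "Y \<in> carrier_mat n n" "Y' \<in> carrier_mat n n"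
    for X X' Y Y' :: "complex mat"
    using that by (subst mult_four_block_mat[of _ 1 1 _ n _ n _ _ 1 _ n]) auto
  have QQ: "mat_adjoint Q * Q = 1\<^sub>m (Suc n)"
    unfolding adjQ unfolding Q_def using P' PP' by (subst fb_mult) auto
  have MQ: "M = Q * D * mat_adjoint Q"
    unfolding M_block adjQ unfolding Q_def D_def A'eq
    using P' D' by (simp add: fb_mult del: One_nat_def)
  have P: "V * Q \<in> carrier_mat (Suc n) (Suc n)"
    using V Q by simp
  have adjP: "mat_adjoint (V * Q) = mat_adjoint Q * mat_adjoint V"
    using V Q by (rule mat_adjoint_mult)
  have "mat_adjoint (V * Q) * (V * Q) = mat_adjoint Q * (mat_adjoint V * (V * Q))"
    unfolding adjP using V Q by (intro assoc_mult_mat) auto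
  also have "mat_adjoint V * (V * Q) = mat_adjoint V * V * Q"
    using V Q by (intro assoc_mult_mat[symmetric]) auto
  finally have PP: "mat_adjoint (V * Q) * (V * Q) = 1\<^sub>m (Suc n)"
    using VV QQ Q by simp
  have "A = V * (Q * D * mat_adjoint Q) * mat_adjoint V"
    using AV MQ by simp
  also have "V * (Q * D * mat_adjoint Q) = V * (Q * D) * mat_adjoint Q"
    using V Q D by (intro assoc_mult_mat[symmetric]) auto
  also have "V * (Q * D) = V * Q * D"
    using V Q D by (intro assoc_mult_mat[symmetric]) auto
  also have "V * Q * D * mat_adjoint Q * mat_adjoint V = V * Q * D * mat_adjoint (V * Q)"
    unfolding adjP using V Q D by (intro assoc_mult_mat) auto
  finally have Aeq: "A = V * Q * D * mat_adjoint (V * Q)" .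
  have "diagonal_mat D"
    unfolding diagonal_mat_def
  proof (intro allI impI)
    fix i j assume "i < dim_row D" "j < dim_col D" "i \<noteq> j"
    with diag D' show "D $$ (i, j) = 0"
      by (cases i; cases j) (auto simp: diagonal_mat_def D_def)
  qed
  with P D PP Aeq show ?case
    by (intro exI[of _ "V * Q"] exI[of _ D] conjI)
qed

section \<open>Positive semidefinite matrices and square roots\<close>

lemma hermitian_mat_congruence:
  assumes "P \<in> carrier_mat m n" "D \<in> carrier_mat n n" "hermitian_mat D"
  shows "hermitian_mat (P * D * mat_adjoint P)"
proof -
  have "mat_adjoint (P * D * mat_adjoint P) = mat_adjoint (mat_adjoint P) * mat_adjoint (P * D)"
    using assms by (intro mat_adjoint_mult[of _ m n _ m]) auto
  also have "mat_adjoint (P * D) = D * mat_adjoint P"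
    using assms by (subst mat_adjoint_mult) (auto simp: hermitian_mat_def)
  also have "mat_adjoint (mat_adjoint P) * (D * mat_adjoint P) = P * D * mat_adjoint P"
    using assms by (simp add: assoc_mult_mat[of P m n D n _ m])
  finally show ?thesis
    by (simp add: hermitian_mat_def)
qed

text \<open>The form of the congruent matrix at v is the form of D at
  \<open>mat_adjoint P *\<^sub>v v\<close>. P may be rectangular, so the lemma also covers Gram
  matrices and compressions to a diagonal block.\<close>

lemma psd_mat_congruence:
  assumes P: "P \<in> carrier_mat m n" and D: "psd_mat n D"
  shows "psd_mat m (P * D * mat_adjoint P)"
proof -
  have Dc: "D \<in> carrier_mat n n" and Dh: "hermitian_mat D"
    using D by (auto simp: psd_mat_def)
  have "0 \<le> (P * D * mat_adjoint P *\<^sub>v v) \<bullet>c v" if v: "v \<in> carrier_vec m" for v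
  proof -
    define w where "w = mat_adjoint P *\<^sub>v v"
    have w: "w \<in> carrier_vec n"
      using P v by (auto simp: w_def intro!: mult_mat_vec_carrier)
    have "P * D * mat_adjoint P *\<^sub>v v = P * D *\<^sub>v w"
      unfolding w_def using P Dc v by (intro assoc_mult_mat_vec) auto
    also have "\<dots> = P *\<^sub>v (D *\<^sub>v w)"
      using P Dc w by (intro assoc_mult_mat_vec) auto
    finally have "(P * D * mat_adjoint P *\<^sub>v v) \<bullet>c v = (D *\<^sub>v w) \<bullet>c w"
      using cscalar_prod_mat_adjoint[OF P _ v, of "D *\<^sub>v w"] Dc w by (simp add: w_def)
    then show ?thesis
      using D w by (simp add: psd_mat_def)
  qed
  then show ?thesis
    using hermitian_mat_congruence[OF P Dc Dh] P Dc by (auto simp: psd_mat_def)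
qed

lemma psd_mat_one: "psd_mat n (1\<^sub>m n)"
  by (auto simp: psd_mat_def hermitian_mat_def)

lemma psd_mat_mult_adjoint:
  assumes "X \<in> carrier_mat m n"
  shows "psd_mat m (X * mat_adjoint X)"
  using psd_mat_congruence[OF assms psd_mat_one] assms by simp

lemma mat_vec_unit_vec_index:
  fixes A :: "'a::semiring_1 mat"
  assumes "A \<in> carrier_mat m n" "i < m" "j < n"
  shows "(A *\<^sub>v unit_vec n j) $ i = A $$ (i, j)"
  using assms by auto

lemma psd_mat_diag_nonneg:
  assumes "psd_mat n A" "i < n"
  shows "0 \<le> A $$ (i, i)"
proof -
  have A: "A \<in> carrier_mat n n"
    using assms by (simp add: psd_mat_def)
  have "conjugate (unit_vec n i) = (unit_vec n i :: complex vec)"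
    using assms by (intro eq_vecI) (auto simp: unit_vec_def)
  then have "(A *\<^sub>v unit_vec n i) \<bullet>c unit_vec n i = A $$ (i, i)"
    using assms A mat_vec_unit_vec_index[OF A assms(2) assms(2)] by simp
  moreover have "0 \<le> (A *\<^sub>v unit_vec n i) \<bullet>c unit_vec n i"
    using assms by (simp add: psd_mat_def)
  ultimately show ?thesis by simp
qed

lemma diagonal_mat_mult_vec:
  fixes D :: "'a::semiring_0 mat"
  assumes D: "D \<in> carrier_mat n n" "diagonal_mat D" and w: "w \<in> carrier_vec n" and i: "i < n"
  shows "(D *\<^sub>v w) $ i = D $$ (i, i) * w $ i"
proof -
  have "(D *\<^sub>v w) $ i = (\<Sum>j = 0..<n. D $$ (i, j) * w $ j)"
    using D w i by (auto simp: scalar_prod_def)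
  also have "\<dots> = (\<Sum>j = 0..<n. if j = i then D $$ (i, i) * w $ i else 0)"
    using D i by (intro sum.cong) (auto simp: diagonal_mat_def)
  also have "\<dots> = D $$ (i, i) * w $ i"
    using i by simp
  finally show ?thesis .
qed

lemma psd_mat_diagonal:
  assumes D: "D \<in> carrier_mat n n" "diagonal_mat D" and nonneg: "\<And>i. i < n \<Longrightarrow> 0 \<le> D $$ (i, i)"
  shows "psd_mat n D"
proof -
  have cnjD: "cnj (D $$ (i, i)) = D $$ (i, i)" if "i < n" for i
    using nonneg[OF that] by (simp add: less_eq_complex_def complex_eq_iff)
  have "hermitian_mat D"
    unfolding hermitian_mat_def
  proof (rule eq_matI)
    fix i j assume "i < dim_row D" "j < dim_col D"
    then show "mat_adjoint D $$ (i, j) = D $$ (i, j)"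
      using D cnjD[of i] by (cases "i = j") (auto simp: diagonal_mat_def)
  qed (use D in auto)
  moreover have "0 \<le> (D *\<^sub>v w) \<bullet>c w" if w: "w \<in> carrier_vec n" for w
  proof -
    have "(D *\<^sub>v w) \<bullet>c w = (\<Sum>i = 0..<n. D $$ (i, i) * (w $ i * conjugate (w $ i)))"
      using w D by (auto simp: scalar_prod_def[of "D *\<^sub>v w"] diagonal_mat_mult_vec[OF D w]
          mult.assoc simp del: index_mult_mat_vec intro!: sum.cong)
    also have "\<dots> \<ge> 0"
      using nonneg by (intro sum_nonneg mult_nonneg_nonneg conjugate_square_positive) auto
    finally show ?thesis .
  qed
  ultimately show ?thesis
    using D by (auto simp: psd_mat_def)
qed

text \<open>Exhibits D as a congruence of A, so that hermitian symmetry and positivity pass from a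
  matrix to its diagonal form.\<close>

lemma unitary_congruence_inverse:
  fixes P :: "complex mat"
  assumes P: "P \<in> carrier_mat n n" "mat_adjoint P * P = 1\<^sub>m n" and D: "D \<in> carrier_mat n n"
  shows "mat_adjoint P * (P * D * mat_adjoint P) * P = D"
proof -
  have "mat_adjoint P * (P * D * mat_adjoint P) * P = mat_adjoint P * (P * D * mat_adjoint P * P)"
    using P D by (intro assoc_mult_mat) auto
  also have "P * D * mat_adjoint P * P = P * D * (mat_adjoint P * P)"
    using P D by (intro assoc_mult_mat) auto
  also have "\<dots> = P * D"
    using P D by simp
  also have "mat_adjoint P * (P * D) = mat_adjoint P * P * D"
    using P D by (intro assoc_mult_mat[symmetric]) auto
  finally show ?thesis
    using P D by simp
qed

lemma psd_mat_sqrt_exists: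
  assumes "psd_mat n A"
  shows "\<exists>S. psd_mat n S \<and> S * S = A"
proof -
  have A: "A \<in> carrier_mat n n" "hermitian_mat A"
    using assms by (auto simp: psd_mat_def)
  obtain P D where P: "P \<in> carrier_mat n n" and D: "D \<in> carrier_mat n n"
    and PP: "mat_adjoint P * P = 1\<^sub>m n" and diag: "diagonal_mat D" and AD: "A = P * D * mat_adjoint P"
    using hermitian_spectral[OF A] by blast
  have "psd_mat n D"
    using psd_mat_congruence[OF mat_adjoint_carrier[OF P] assms] unitary_congruence_inverse[OF P PP D]
    by (simp add: AD)
  then have nonneg: "0 \<le> D $$ (i, i)" if "i < n" for i
    using psd_mat_diag_nonneg that by blast
  \<comment> \<open>The diagonal of \<open>D\<close> is nonnegative by now, and there
    \<open>csqrt\<close> is the ordinary nonnegative root, so \<open>R\<close> is again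
    positive.\<close>
  define R where "R = mat n n (\<lambda>(i, j). if i = j then csqrt (D $$ (i, i)) else 0)"
  have R: "R \<in> carrier_mat n n" "diagonal_mat R"
    by (auto simp: R_def diagonal_mat_def)
  have "0 \<le> csqrt z" if "0 \<le> z" for z
    using that by (simp add: less_eq_complex_def csqrt_of_real_nonneg)
  then have psdR: "psd_mat n R"
    using psd_mat_diagonal[OF R] nonneg by (simp add: R_def)
  have RR: "R * R = D"
  proof (rule eq_matI)
    fix i j assume "i < dim_row D" "j < dim_col D"
    then have ij: "i < n" "j < n" using D by auto
    have "(R * R) $$ (i, j) = (R *\<^sub>v col R j) $ i"
      using R ij by simp
    also have "\<dots> = R $$ (i, i) * R $$ (i, j)"
      using R ij by (subst diagonal_mat_mult_vec[OF R]) auto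
    also have "\<dots> = D $$ (i, j)"
      using ij D diag by (auto simp: R_def diagonal_mat_def simp flip: power2_eq_square)
    finally show "(R * R) $$ (i, j) = D $$ (i, j)" .
  qed (use R D in auto)
  define S where "S = P * R * mat_adjoint P"
  have "S * S = P * R * (mat_adjoint P * (P * R * mat_adjoint P))"
    unfolding S_def using P R by (intro assoc_mult_mat) auto
  also have "mat_adjoint P * (P * R * mat_adjoint P) = mat_adjoint P * (P * R) * mat_adjoint P"
    using P R by (intro assoc_mult_mat[symmetric]) auto
  also have "mat_adjoint P * (P * R) = mat_adjoint P * P * R"
    using P R by (intro assoc_mult_mat[symmetric]) auto
  also have "\<dots> = R"
    using PP R by simp
  also have "P * R * (R * mat_adjoint P) = P * R * R * mat_adjoint P"
    using P R by (intro assoc_mult_mat[symmetric]) auto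
  also have "P * R * R = P * (R * R)"
    using P R by (intro assoc_mult_mat) auto
  finally have "S * S = A"
    by (simp add: RR AD)
  moreover have "psd_mat n S"
    unfolding S_def using psd_mat_congruence[OF P psdR] .
  ultimately show ?thesis by blast
qed

text \<open>From A P = P D the columns of P are eigenvectors for the diagonal entries of D. These
  are real because D inherits hermitian symmetry from A, so testing real eigenvalues is
  enough.\<close>

lemma psd_mat_if_eigenvalues_nonneg:
  assumes A: "A \<in> carrier_mat n n" "hermitian_mat A"
    and ev: "\<And>e v. eigenvector A v (complex_of_real e) \<Longrightarrow> 0 \<le> e"
  shows "psd_mat n A"
proof -
  obtain P D where P: "P \<in> carrier_mat n n" and D: "D \<in> carrier_mat n n"
    and PP: "mat_adjoint P * P = 1\<^sub>m n" and diag: "diagonal_mat D" and AD: "A = P * D * mat_adjoint P"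
    using hermitian_spectral[OF A] by blast
  have "hermitian_mat D"
    using hermitian_mat_congruence[OF mat_adjoint_carrier[OF P] A] unitary_congruence_inverse[OF P PP D]
    by (simp add: AD)
  then have adjD: "mat_adjoint D = D"
    by (simp add: hermitian_mat_def)
  have "A * P = P * D * (mat_adjoint P * P)"
    unfolding AD using P D by (intro assoc_mult_mat) auto
  then have AP: "A * P = P * D"
    using PP P D by simp
  have "0 \<le> D $$ (i, i)" if i: "i < n" for i
  proof -
    have ci: "col P i \<in> carrier_vec n"
      using P by (metis carrier_matD(1) col_dim)
    have Dii: "D $$ (i, i) = complex_of_real (Re (D $$ (i, i)))"
      using arg_cong[OF adjD, of "\<lambda>X. X $$ (i, i)"] i D by (auto simp: complex_eq_iff)
    have "A *\<^sub>v col P i = col (A * P) i"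
      using A P i by (metis carrier_matD(2) col_mult2)
    also have "\<dots> = P *\<^sub>v col D i"
      unfolding AP using D P i by (metis carrier_matD(2) col_mult2)
    also have "col D i = D $$ (i, i) \<cdot>\<^sub>v unit_vec n i"
      using D diag i by (intro eq_vecI) (auto simp: diagonal_mat_def)
    also have "P *\<^sub>v (D $$ (i, i) \<cdot>\<^sub>v unit_vec n i) = D $$ (i, i) \<cdot>\<^sub>v (P *\<^sub>v unit_vec n i)"
      using P by (intro mult_mat_vec) auto
    also have "P *\<^sub>v unit_vec n i = col P i"
      using P i by (intro eq_vecI) auto
    finally have "A *\<^sub>v col P i = complex_of_real (Re (D $$ (i, i))) \<cdot>\<^sub>v col P i"
      using Dii by simp
    \<comment> \<open>A zero column would produce a zero on the diagonal of
      \<open>mat_adjoint P * P\<close>, which is the identity.\<close>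
    moreover have "col P i \<noteq> 0\<^sub>v n"
    proof
      assume "col P i = 0\<^sub>v n"
      then have "(mat_adjoint P * P) $$ (i, i) = 0"
        using P i by simp
      then show False
        using PP i by simp
    qed
    ultimately have "eigenvector A (col P i) (complex_of_real (Re (D $$ (i, i))))"
      using A ci by (simp add: eigenvector_def)
    then have "0 \<le> Re (D $$ (i, i))"
      by (rule ev)
    then show ?thesis
      by (subst Dii) (simp add: less_eq_complex_def)
  qed
  then show ?thesis
    unfolding AD using psd_mat_congruence[OF P psd_mat_diagonal[OF D diag]] by blast
qed

section \<open>Operator monotonicity of the square root\<close>

lemma cscalar_prod_self_add_smult:
  fixes u v :: "complex vec" and r :: real
  assumes "u \<in> carrier_vec n" "v \<in> carrier_vec n"
  shows "Re ((u + complex_of_real r \<cdot>\<^sub>v v) \<bullet>c (u + complex_of_real r \<cdot>\<^sub>v v))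
    = Re (u \<bullet>c u) + 2 * r * Re (u \<bullet>c v) + r\<^sup>2 * Re (v \<bullet>c v)"
proof -
  have "Re ((u + complex_of_real r \<cdot>\<^sub>v v) \<bullet>c (u + complex_of_real r \<cdot>\<^sub>v v))
      = (\<Sum>i = 0..<n. Re ((u $ i + r * v $ i) * cnj (u $ i + r * v $ i)))"
    using assms by (auto simp: scalar_prod_def intro!: sum.cong)
  also have "\<dots> = (\<Sum>i = 0..<n. Re (u $ i * cnj (u $ i)) + 2 * r * Re (u $ i * cnj (v $ i))
      + r\<^sup>2 * Re (v $ i * cnj (v $ i)))"
    by (intro sum.cong) (simp_all add: power2_eq_square algebra_simps)
  also have "\<dots> = Re (u \<bullet>c u) + 2 * r * Re (u \<bullet>c v) + r\<^sup>2 * Re (v \<bullet>c v)"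
    using assms unfolding sum.distrib sum_distrib_left[symmetric] by (simp add: scalar_prod_def)
  finally show ?thesis .
qed

text \<open>
  If \<open>(B - A) v = - m v\<close> with \<open>m > 0\<close> then \<open>A v = B v + m v\<close>, which is strictly longer
  than \<open>B v\<close> because \<open>B\<close> is positive.
\<close>

lemma psd_mat_diff_if_norm_le:
  assumes A: "psd_mat n A" and B: "psd_mat n B"
    and le: "\<And>v. v \<in> carrier_vec n \<Longrightarrow>
      Re ((A *\<^sub>v v) \<bullet>c (A *\<^sub>v v)) \<le> Re ((B *\<^sub>v v) \<bullet>c (B *\<^sub>v v))"
  shows "psd_mat n (B - A)"
proof (rule psd_mat_if_eigenvalues_nonneg)
  have Ac: "A \<in> carrier_mat n n" "hermitian_mat A" and Bc: "B \<in> carrier_mat n n" "hermitian_mat B"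
    using A B by (auto simp: psd_mat_def)
  show "B - A \<in> carrier_mat n n"
    using Ac Bc by auto
  show "hermitian_mat (B - A)"
    using Ac Bc mat_adjoint_minus[OF Bc(1) Ac(1)] by (simp add: hermitian_mat_def)
  fix e v assume "eigenvector (B - A) v (complex_of_real e)"
  then have v: "v \<in> carrier_vec n" "v \<noteq> 0\<^sub>v n" and ev: "(B - A) *\<^sub>v v = complex_of_real e \<cdot>\<^sub>v v"
    using Ac Bc by (auto simp: eigenvector_def)
  have Av: "A *\<^sub>v v \<in> carrier_vec n" and Bv: "B *\<^sub>v v \<in> carrier_vec n"
    using Ac Bc v by auto
  have diff: "B *\<^sub>v v - A *\<^sub>v v = complex_of_real e \<cdot>\<^sub>v v"
    using ev minus_mult_distrib_mat_vec[OF Bc(1) Ac(1) v(1)] by simp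
  have Aeq: "A *\<^sub>v v = B *\<^sub>v v + complex_of_real (- e) \<cdot>\<^sub>v v"
  proof (rule eq_vecI)
    fix i assume "i < dim_vec (B *\<^sub>v v + complex_of_real (- e) \<cdot>\<^sub>v v)"
    then have i: "i < n" using v by simp
    then show "(A *\<^sub>v v) $ i = (B *\<^sub>v v + complex_of_real (- e) \<cdot>\<^sub>v v) $ i"
      using arg_cong[OF diff, of "\<lambda>w. w $ i"] Av Bv v Ac Bc by (simp add: algebra_simps)
  qed (use v Ac Bc in auto)
  have vv: "0 < Re (v \<bullet>c v)"
    using conjugate_square_greater_0_vec[OF v(1)] v(2) by (simp add: less_complex_def)
  have Bvv: "0 \<le> Re ((B *\<^sub>v v) \<bullet>c v)"
    using B v by (simp add: psd_mat_def less_eq_complex_def)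
  show "0 \<le> e"
  proof (rule ccontr)
    assume "\<not> 0 \<le> e"
    then have "0 \<le> 2 * (- e) * Re ((B *\<^sub>v v) \<bullet>c v)" "0 < (- e)\<^sup>2 * Re (v \<bullet>c v)"
      using Bvv vv by (auto intro!: mult_nonpos_nonneg mult_pos_pos)
    moreover have "Re ((A *\<^sub>v v) \<bullet>c (A *\<^sub>v v)) = Re ((B *\<^sub>v v) \<bullet>c (B *\<^sub>v v))
        + 2 * (- e) * Re ((B *\<^sub>v v) \<bullet>c v) + (- e)\<^sup>2 * Re (v \<bullet>c v)"
      unfolding Aeq by (rule cscalar_prod_self_add_smult[OF Bv v(1)])
    ultimately show False
      using le[OF v(1)] by linarith
  qed
qed

text \<open>Translates the comparison of lengths in \<open>psd_mat_diff_if_norm_le\<close> into a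
  comparison of the squares of the matrices.\<close>

lemma hermitian_cscalar_prod_self:
  assumes S: "S \<in> carrier_mat n n" "hermitian_mat S" and v: "v \<in> carrier_vec n"
  shows "(S *\<^sub>v v) \<bullet>c (S *\<^sub>v v) = ((S * S) *\<^sub>v v) \<bullet>c v"
proof -
  have Sv: "S *\<^sub>v v \<in> carrier_vec n"
    using S v by auto
  show ?thesis
    using cscalar_prod_mat_adjoint[OF S(1) Sv v] S v by (simp add: hermitian_mat_def)
qed

section \<open>Antisymmetry of the order and uniqueness of the positive root\<close>

lemma mat_eq_zero_if_mult_vec_zero:
  fixes A :: "'a::semiring_1 mat"
  assumes A: "A \<in> carrier_mat m n" and z: "\<And>v. v \<in> carrier_vec n \<Longrightarrow> A *\<^sub>v v = 0\<^sub>v m"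
  shows "A = 0\<^sub>m m n"
proof (rule eq_matI)
  fix i j assume "i < dim_row (0\<^sub>m m n :: 'a mat)" "j < dim_col (0\<^sub>m m n :: 'a mat)"
  then show "A $$ (i, j) = 0\<^sub>m m n $$ (i, j)"
    using mat_vec_unit_vec_index[OF A, of i j] z[of "unit_vec n j"] by simp
qed (use A in auto)

text \<open>The quadratic form of A - B vanishes identically. With S a root of A - B, that form at v
  is the squared length of S v, so S = 0 and hence A - B = 0. The root avoids polarisation.\<close>

lemma psd_mat_antisym:
  assumes M: "psd_mat n (A - B)" and N: "psd_mat n (B - A)"
    and A: "A \<in> carrier_mat n n" and B: "B \<in> carrier_mat n n"
  shows "A = B"
proof -
  obtain S where S: "psd_mat n S" "S * S = A - B"
    using psd_mat_sqrt_exists[OF M] by blast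
  have Sc: "S \<in> carrier_mat n n" "hermitian_mat S"
    using S by (auto simp: psd_mat_def)
  have "S *\<^sub>v v = 0\<^sub>v n" if v: "v \<in> carrier_vec n" for v
  proof -
    have Av: "A *\<^sub>v v \<in> carrier_vec n" "B *\<^sub>v v \<in> carrier_vec n"
      using A B v by auto
    have "((A - B) *\<^sub>v v) \<bullet>c v = (A *\<^sub>v v) \<bullet>c v - (B *\<^sub>v v) \<bullet>c v"
      "((B - A) *\<^sub>v v) \<bullet>c v = (B *\<^sub>v v) \<bullet>c v - (A *\<^sub>v v) \<bullet>c v"
      using minus_mult_distrib_mat_vec[OF A B v] minus_mult_distrib_mat_vec[OF B A v]
        minus_scalar_prod_distrib[OF Av carrier_vec_conjugate[OF v]]
        minus_scalar_prod_distrib[OF Av(2,1) carrier_vec_conjugate[OF v]] by simp_all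
    moreover have "0 \<le> ((A - B) *\<^sub>v v) \<bullet>c v" "0 \<le> ((B - A) *\<^sub>v v) \<bullet>c v"
      using M N v by (auto simp: psd_mat_def)
    ultimately have "((A - B) *\<^sub>v v) \<bullet>c v = 0"
      by (simp add: less_eq_complex_def complex_eq_iff)
    then have "(S *\<^sub>v v) \<bullet>c (S *\<^sub>v v) = 0"
      using hermitian_cscalar_prod_self[OF Sc v] S by simp
    then show ?thesis
      using Sc v conjugate_square_eq_0_vec[of "S *\<^sub>v v" n] by auto
  qed
  then have "S = 0\<^sub>m n n"
    by (rule mat_eq_zero_if_mult_vec_zero[OF Sc(1)])
  then have D: "A - B = 0\<^sub>m n n"
    using S by simp
  show ?thesis
  proof (rule eq_matI)
    fix i j assume "i < dim_row B" "j < dim_col B"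
    then show "A $$ (i, j) = B $$ (i, j)"
      using arg_cong[OF D, of "\<lambda>X. X $$ (i, j)"] A B by simp
  qed (use A B in auto)
qed

text \<open>Two positive roots S and T of A satisfy |S v| = |T v| for all v, since both squared
  lengths are the form of A at v. Monotonicity then gives S and T in either order, and antisymmetry
  makes the description in \<open>psd_sqrt_def\<close> unique.\<close>

lemma psd_sqrt:
  assumes "psd_mat n A"
  shows "psd_mat n (psd_sqrt A)" "psd_sqrt A * psd_sqrt A = A"
proof -
  obtain S where S: "psd_mat n S" "S * S = A"
    using psd_mat_sqrt_exists[OF assms] by blast
  have le: "psd_mat n (T - S)"
    if S: "psd_mat n S" "S * S = A" and T: "psd_mat n T" "T * T = A" for S T
    using psd_mat_diff_if_norm_le[OF S(1) T(1)] hermitian_cscalar_prod_self[of S n]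
      hermitian_cscalar_prod_self[of T n] S T by (simp add: psd_mat_def)
  have "T = S" if T: "psd_mat n T" "T * T = A" for T
    using psd_mat_antisym[OF le[OF S T] le[OF T S]] S T by (simp add: psd_mat_def)
  then have "\<exists>!S. psd_mat n S \<and> S * S = A"
    using S by blast
  moreover have "dim_row A = n"
    using assms by (auto simp: psd_mat_def)
  ultimately show "psd_mat n (psd_sqrt A)" "psd_sqrt A * psd_sqrt A = A"
    unfolding psd_sqrt_def using theI'[of "\<lambda>S. psd_mat n S \<and> S * S = A"] by auto
qed

lemma psd_mat_add:
  assumes "psd_mat n A" "psd_mat n B"
  shows "psd_mat n (A + B)"
proof -
  have A: "A \<in> carrier_mat n n" and B: "B \<in> carrier_mat n n"
    using assms by (auto simp: psd_mat_def)
  have "((A + B) *\<^sub>v v) \<bullet>c v = (A *\<^sub>v v) \<bullet>c v + (B *\<^sub>v v) \<bullet>c v" if "v \<in> carrier_vec n" for v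
    using cscalar_prod_left_add[of "A *\<^sub>v v" n "B *\<^sub>v v" v] that A B
      add_mult_distrib_mat_vec[OF A B that] by simp
  then show ?thesis
    using assms A B by (auto simp: psd_mat_def hermitian_mat_def mat_adjoint_add)
qed

lemma smult_mat_mult_vec:
  fixes A :: "'a::comm_semiring_1 mat"
  assumes "A \<in> carrier_mat m n" "v \<in> carrier_vec n"
  shows "(c \<cdot>\<^sub>m A) *\<^sub>v v = c \<cdot>\<^sub>v (A *\<^sub>v v)"
  using assms by (intro eq_vecI) (auto simp: scalar_prod_def sum_distrib_left mult.assoc)

lemma psd_mat_smult:
  assumes "psd_mat n A" "0 \<le> c"
  shows "psd_mat n (c \<cdot>\<^sub>m A)"
proof -
  have A: "A \<in> carrier_mat n n"
    using assms by (simp add: psd_mat_def)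
  have c: "cnj c = c"
    using assms by (simp add: less_eq_complex_def complex_eq_iff)
  have "(c \<cdot>\<^sub>m A *\<^sub>v v) \<bullet>c v = c * ((A *\<^sub>v v) \<bullet>c v)" if "v \<in> carrier_vec n" for v
    using A that by (simp add: smult_mat_mult_vec[OF A that])
  then show ?thesis
    using assms c by (auto simp: psd_mat_def hermitian_mat_def mat_adjoint_smult)
qed

section \<open>Euclidean length and the absolute value of a matrix\<close>

definition vnorm :: "complex vec \<Rightarrow> real" where
  "vnorm v = L2_set (\<lambda>i. cmod (v $ i)) {0..<dim_vec v}"

lemma vnorm_nonneg [simp]: "0 \<le> vnorm v"
  by (simp add: vnorm_def L2_set_nonneg)

lemma cscalar_prod_self: "v \<bullet>c v = complex_of_real ((vnorm v)\<^sup>2)"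
proof -
  have "(vnorm v)\<^sup>2 = (\<Sum>i = 0..<dim_vec v. (cmod (v $ i))\<^sup>2)"
    by (simp add: vnorm_def L2_set_def sum_nonneg)
  then show ?thesis
    by (simp add: scalar_prod_def complex_norm_square del: of_real_power)
qed

lemma vnorm_triangle:
  assumes "u \<in> carrier_vec n" "v \<in> carrier_vec n"
  shows "vnorm (u + v) \<le> vnorm u + vnorm v"
proof -
  have "vnorm (u + v) \<le> L2_set (\<lambda>i. cmod (u $ i) + cmod (v $ i)) {0..<n}"
    using assms unfolding vnorm_def by (auto intro!: L2_set_mono norm_triangle_ineq)
  also have "\<dots> \<le> vnorm u + vnorm v"
    using assms L2_set_triangle_ineq unfolding vnorm_def by auto
  finally show ?thesis .
qed

lemma psd_mat_abs:
  assumes "X \<in> carrier_mat m n"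
  shows "psd_mat n (mat_abs X)" "mat_abs X * mat_abs X = mat_adjoint X * X"
  using psd_sqrt[OF psd_mat_mult_adjoint[OF mat_adjoint_carrier[OF assms]]]
  by (simp_all add: mat_abs_def)

text \<open>Both squared lengths are the quadratic form of \<open>mat_adjoint X * X\<close> at
  v.\<close>

lemma vnorm_mat_abs:
  assumes X: "X \<in> carrier_mat m n" and v: "v \<in> carrier_vec n"
  shows "vnorm (mat_abs X *\<^sub>v v) = vnorm (X *\<^sub>v v)"
proof -
  have Xv: "X *\<^sub>v v \<in> carrier_vec m"
    using X v by auto
  have "(mat_abs X *\<^sub>v v) \<bullet>c (mat_abs X *\<^sub>v v) = (mat_adjoint X * X *\<^sub>v v) \<bullet>c v"
    using psd_mat_abs[OF X] hermitian_cscalar_prod_self[OF _ _ v, of "mat_abs X"]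
    by (simp add: psd_mat_def)
  also have "mat_adjoint X * X *\<^sub>v v = mat_adjoint X *\<^sub>v (X *\<^sub>v v)"
    using X v by (intro assoc_mult_mat_vec) auto
  also have "(mat_adjoint X *\<^sub>v (X *\<^sub>v v)) \<bullet>c v = (X *\<^sub>v v) \<bullet>c (X *\<^sub>v v)"
    using cscalar_prod_mat_adjoint[OF mat_adjoint_carrier[OF X] Xv v] by simp
  finally have "(vnorm (mat_abs X *\<^sub>v v))\<^sup>2 = (vnorm (X *\<^sub>v v))\<^sup>2"
    unfolding cscalar_prod_self of_real_eq_iff .
  then show ?thesis
    by (simp add: power2_eq_iff_nonneg)
qed

section \<open>The scalar inequality\<close>

text \<open>Stands in for dividing by r^2 and letting r tend to infinity.\<close>

lemma quadratic_leading_coeff_nonneg: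
  fixes \<alpha> \<beta> \<gamma> :: real
  assumes "\<And>r. r > 0 \<Longrightarrow> 0 \<le> \<alpha> * r\<^sup>2 + \<beta> * r + \<gamma>"
  shows "0 \<le> \<alpha>"
proof (rule ccontr)
  assume "\<not> 0 \<le> \<alpha>"
  define d where "d = - \<alpha>"
  have d: "d > 0" "\<alpha> = - d"
    using \<open>\<not> 0 \<le> \<alpha>\<close> by (auto simp: d_def)
  \<comment> \<open>Large enough that d r exceeds both lower coefficients together by 1; r at least
    1 lets the constant term be bounded by a linear one.\<close>
  define r where "r = max 1 ((\<bar>\<beta>\<bar> + \<bar>\<gamma>\<bar> + 1) / d)"
  have r: "r \<ge> 1" "(\<bar>\<beta>\<bar> + \<bar>\<gamma>\<bar> + 1) / d \<le> r"
    by (auto simp: r_def)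
  have "\<bar>\<beta>\<bar> + \<bar>\<gamma>\<bar> + 1 \<le> d * r"
    using r(2) d(1) by (simp add: divide_le_eq mult.commute)
  then have "(\<bar>\<beta>\<bar> + \<bar>\<gamma>\<bar> + 1) * r \<le> d * r * r"
    using r(1) by (intro mult_right_mono) auto
  then have "\<bar>\<beta>\<bar> * r + \<bar>\<gamma>\<bar> * r + r \<le> d * r * r"
    by (simp add: distrib_right)
  moreover have "\<beta> * r \<le> \<bar>\<beta>\<bar> * r" "\<gamma> \<le> \<bar>\<gamma>\<bar> * r"
    using r(1) mult_left_mono[of 1 r "\<bar>\<gamma>\<bar>"] by (auto intro: mult_right_mono)
  moreover have "\<alpha> * r\<^sup>2 = - (d * r * r)"
    by (simp add: d(2) power2_eq_square)
  ultimately have "\<alpha> * r\<^sup>2 + \<beta> * r + \<gamma> < 0"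
    using r(1) by linarith
  then show False
    using assms[of r] r(1) by linarith
qed

text \<open>Turning y by minus half the difference of the arguments and z by plus half of it brings
  both to the mean argument. If y or z is 0 its argument is a mere convention, but the polar form
  still holds.\<close>

lemma exists_phase_aligning:
  fixes y z :: complex
  obtains w where "cmod w = 1" "cmod (cnj w * y + w * z) = cmod y + cmod z"
proof -
  define \<alpha> \<beta> where "\<alpha> = Arg y" and "\<beta> = Arg z"
  define w where "w = cis ((\<alpha> - \<beta>) / 2)"
  have y: "y = complex_of_real (cmod y) * cis \<alpha>" and z: "z = complex_of_real (cmod z) * cis \<beta>"
    using rcis_cmod_Arg[of y] rcis_cmod_Arg[of z] by (simp_all add: rcis_def \<alpha>_def \<beta>_def)
  have half: "- ((\<alpha> - \<beta>) / 2) + \<alpha> = (\<alpha> + \<beta>) / 2" "(\<alpha> - \<beta>) / 2 + \<beta> = (\<alpha> + \<beta>) / 2"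
    by (simp_all add: field_simps)
  have "cnj w * cis \<alpha> = cis ((\<alpha> + \<beta>) / 2)" "w * cis \<beta> = cis ((\<alpha> + \<beta>) / 2)"
    by (simp_all only: w_def cis_cnj cis_mult half)
  moreover have "cnj w * y = complex_of_real (cmod y) * (cnj w * cis \<alpha>)"
    "w * z = complex_of_real (cmod z) * (w * cis \<beta>)"
    using y z by (metis mult.left_commute)+
  ultimately have "cnj w * y + w * z = complex_of_real (cmod y + cmod z) * cis ((\<alpha> + \<beta>) / 2)"
    by (simp only: of_real_add distrib_right)
  then have "cmod (cnj w * y + w * z) = cmod y + cmod z"
    by (simp add: norm_mult flip: of_real_add)
  then show ?thesis
    using that[of w] by (simp add: w_def)
qed

text \<open>
  The hypothesis is the positivity of \<open>\<phi> [[1, cnj q], [q, |q|^2]]\<close> at the vector \<open>(s, v)\<close>.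
  Its part of top degree in \<open>(s, q)\<close> has degree 3 and contains only \<open>x\<close>, so \<open>x = 0\<close>;
  then the quadratic part must be nonnegative.
\<close>

lemma positive_form_bound:
  fixes a b u :: real and c x y z t t' :: complex
  assumes a: "0 \<le> a" and H: "\<And>s q. 0 \<le> a * (cmod s)\<^sup>2 + 2 * Re (cnj s * c) + b
      + Re (cnj q * (x * complex_of_real ((cmod s)\<^sup>2) + cnj s * y + s * cnj z + t))
      + Re (q * (cnj x * complex_of_real ((cmod s)\<^sup>2) + cnj s * z + s * cnj y + t'))
      + (cmod q)\<^sup>2 * u"
  shows "(cmod y + cmod z)\<^sup>2 \<le> a * u"
proof -
  \<comment> \<open>For fixed q and real s = r, only the terms quadratic in s contribute to the
    coefficient of r^2.\<close>
  have x1: "0 \<le> a + 2 * Re (cnj q * x)" for q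
  proof (rule quadratic_leading_coeff_nonneg)
    fix r :: real
    show "0 \<le> (a + 2 * Re (cnj q * x)) * r\<^sup>2
        + (2 * Re c + 2 * Re (cnj q * y) + 2 * Re (q * z)) * r
        + (b + Re (cnj q * t) + Re (q * t') + (cmod q)\<^sup>2 * u)"
      using H[of "complex_of_real r" q] by (simp add: algebra_simps)
  qed
  have x: "x = 0"
  proof -
    \<comment> \<open>Taking q = - r^2 x in \<open>x1\<close> gives a - 2 r^2 |x|^2. The parameter
      is squared so that |x|^2 lands in the leading coefficient.\<close>
    have "0 \<le> (- 2 * (cmod x)\<^sup>2) * r\<^sup>2 + 0 * r + a" for r :: real
    proof -
      have "Re (cnj (complex_of_real (- (r\<^sup>2)) * x) * x) = - (r\<^sup>2) * (cmod x)\<^sup>2"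
        unfolding cmod_power2 by (simp add: power2_eq_square algebra_simps)
      from x1[of "complex_of_real (- (r\<^sup>2)) * x", unfolded this] show ?thesis
        by (simp add: algebra_simps)
    qed
    then have "0 \<le> - 2 * (cmod x)\<^sup>2"
      by (rule quadratic_leading_coeff_nonneg)
    then show ?thesis by simp
  qed
  obtain w where w: "cmod w = 1" "cmod (cnj w * y + w * z) = cmod y + cmod z"
    using exists_phase_aligning .
  define k where "k = cnj w * y + w * z"
  \<comment> \<open>Scaling s and q = r w together makes the a, u and cross terms all of order r^2.
    The cross terms from the two off-diagonal blocks are conjugate to each other, hence the factor 2
    before the real part.\<close>
  have quad: "0 \<le> a * (cmod s)\<^sup>2 + 2 * Re (cnj s * k) + u" for s
  proof (rule quadratic_leading_coeff_nonneg)
    fix r :: real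
    have "(cmod (complex_of_real r * w))\<^sup>2 = r\<^sup>2" "(cmod (complex_of_real r * s))\<^sup>2 = r\<^sup>2 * (cmod s)\<^sup>2"
      using w by (simp_all add: norm_mult power_mult_distrib)
    then show "0 \<le> (a * (cmod s)\<^sup>2 + 2 * Re (cnj s * k) + u) * r\<^sup>2
        + (2 * Re (cnj s * c) + Re (cnj w * t) + Re (w * t')) * r + b"
      using H[of "complex_of_real r * s" "complex_of_real r * w"] x
      by (simp add: k_def algebra_simps power2_eq_square)
  qed
  have quad': "0 \<le> a * (\<tau>\<^sup>2 * (cmod k)\<^sup>2) - 2 * \<tau> * (cmod k)\<^sup>2 + u" for \<tau> :: real
  proof -
    have "Re (cnj (complex_of_real (- \<tau>) * k) * k) = - \<tau> * (cmod k)\<^sup>2"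
      unfolding cmod_power2 by (simp add: power2_eq_square algebra_simps)
    moreover have "(cmod (complex_of_real (- \<tau>) * k))\<^sup>2 = \<tau>\<^sup>2 * (cmod k)\<^sup>2"
      by (simp add: norm_mult power_mult_distrib)
    ultimately show ?thesis
      using quad[of "complex_of_real (- \<tau>) * k"] by simp
  qed
  have "(cmod k)\<^sup>2 \<le> a * u"
  \<comment> \<open>For a > 0 the bound is sharpest at its minimiser \<tau> = 1 / a. For a = 0 there
    is no minimiser unless k = 0: letting \<tau> = r^2 grow forces k = 0.\<close>
  proof (cases "a = 0")
    case True
    have "0 \<le> (- 2 * (cmod k)\<^sup>2) * r\<^sup>2 + 0 * r + u" for r :: real
      using quad'[of "r\<^sup>2"] True by (simp add: mult_ac)
    then have "0 \<le> - 2 * (cmod k)\<^sup>2"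
      by (rule quadratic_leading_coeff_nonneg)
    then show ?thesis
      using True by simp
  next
    case False
    with a have "a > 0" by simp
    then show ?thesis
      using quad'[of "1 / a"] by (simp add: field_simps power2_eq_square)
  qed
  then show ?thesis
    using w(2) by (simp add: k_def)
qed

section \<open>Positive maps on two by two matrices\<close>

text \<open>Used to read the values of \<phi> on the matrix units off the equation for the Choi
  matrix.\<close>

lemma four_block_mat_inject:
  assumes "A \<in> carrier_mat r\<^sub>1 c\<^sub>1" "B \<in> carrier_mat r\<^sub>1 c\<^sub>2" "C \<in> carrier_mat r\<^sub>2 c\<^sub>1" "D \<in> carrier_mat r\<^sub>2 c\<^sub>2"
    and "A' \<in> carrier_mat r\<^sub>1 c\<^sub>1" "B' \<in> carrier_mat r\<^sub>1 c\<^sub>2" "C' \<in> carrier_mat r\<^sub>2 c\<^sub>1" "D' \<in> carrier_mat r\<^sub>2 c\<^sub>2"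
    and eq: "four_block_mat A B C D = four_block_mat A' B' C' D'"
  shows "A = A'" "B = B'" "C = C'" "D = D'"
proof -
  have idx: "four_block_mat A B C D $$ (i, j) = four_block_mat A' B' C' D' $$ (i, j)" for i j
    using eq by simp
  have "A $$ (i, j) = A' $$ (i, j)" if "i < r\<^sub>1" "j < c\<^sub>1" for i j
    using idx[of i j] assms(1-8) that by simp
  then show "A = A'"
    using assms by (intro eq_matI) auto
  have "B $$ (i, j) = B' $$ (i, j)" if "i < r\<^sub>1" "j < c\<^sub>2" for i j
    using idx[of i "c\<^sub>1 + j"] assms(1-8) that by simp
  then show "B = B'"
    using assms by (intro eq_matI) auto
  have "C $$ (i, j) = C' $$ (i, j)" if "i < r\<^sub>2" "j < c\<^sub>1" for i j
    using idx[of "r\<^sub>1 + i" j] assms(1-8) that by simp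
  then show "C = C'"
    using assms by (intro eq_matI) auto
  have "D $$ (i, j) = D' $$ (i, j)" if "i < r\<^sub>2" "j < c\<^sub>2" for i j
    using idx[of "r\<^sub>1 + i" "c\<^sub>1 + j"] assms(1-8) that by simp
  then show "D = D'"
    using assms by (intro eq_matI) auto
qed

text \<open>The lower left block is written as an adjoint so that it can be moved across the inner
  product and leave a conjugated number. R and K are independent because the off-diagonal Choi
  blocks pair Y with Z.\<close>

lemma block_form:
  fixes R K N :: "complex mat" and m s :: complex
  assumes R: "R \<in> carrier_mat 1 n" and K: "K \<in> carrier_mat 1 n" and N: "N \<in> carrier_mat n n"
    and v: "v \<in> carrier_vec n"
  defines "w \<equiv> vec 1 (\<lambda>_. s) @\<^sub>v v"
  shows "(four_block_mat (scalar_mat m) R (mat_adjoint K) N *\<^sub>v w) \<bullet>c w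
    = m * complex_of_real ((cmod s)\<^sup>2) + cnj s * (R *\<^sub>v v) $ 0 + s * cnj ((K *\<^sub>v v) $ 0)
      + (N *\<^sub>v v) \<bullet>c v"
proof -
  let ?s = "vec 1 (\<lambda>_. s)"
  have s: "?s \<in> carrier_vec 1" and m: "scalar_mat m \<in> carrier_mat 1 1"
    by (auto simp: scalar_mat_def)
  have Rv: "R *\<^sub>v v \<in> carrier_vec 1" and Kv: "K *\<^sub>v v \<in> carrier_vec 1" and Nv: "N *\<^sub>v v \<in> carrier_vec n"
    and ms: "scalar_mat m *\<^sub>v ?s \<in> carrier_vec 1"
    using assms s m by auto
  have Ks: "mat_adjoint K *\<^sub>v ?s \<in> carrier_vec n"
    using mult_mat_vec_carrier[OF mat_adjoint_carrier[OF K] s] .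
  have conj: "conjugate w = conjugate ?s @\<^sub>v conjugate v"
    unfolding w_def by (intro eq_vecI) auto
  have "(four_block_mat (scalar_mat m) R (mat_adjoint K) N *\<^sub>v w) \<bullet>c w
      = (scalar_mat m *\<^sub>v ?s + R *\<^sub>v v) \<bullet>c ?s + (mat_adjoint K *\<^sub>v ?s + N *\<^sub>v v) \<bullet>c v"
    unfolding conj unfolding w_def
    using four_block_mat_mult_vec[OF m R mat_adjoint_carrier[OF K] N s v]
    by (simp del: One_nat_def)
      (intro scalar_prod_append[of _ 1 _ n] add_carrier_vec Rv Nv Ks ms
        carrier_vec_conjugate s v)
  also have "(mat_adjoint K *\<^sub>v ?s + N *\<^sub>v v) \<bullet>c v = ?s \<bullet>c (K *\<^sub>v v) + (N *\<^sub>v v) \<bullet>c v"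
    using cscalar_prod_left_add[OF Ks Nv v] cscalar_prod_mat_adjoint[OF mat_adjoint_carrier[OF K] s v]
    by simp
  also have "?s \<bullet>c (K *\<^sub>v v) = s * cnj ((K *\<^sub>v v) $ 0)"
    using K by (simp add: scalar_prod_def del: index_mult_mat_vec)
  also have "(scalar_mat m *\<^sub>v ?s + R *\<^sub>v v) \<bullet>c ?s
      = m * complex_of_real ((cmod s)\<^sup>2) + cnj s * (R *\<^sub>v v) $ 0"
    unfolding cscalar_prod_left_add[OF ms Rv s] complex_norm_square
    using R by (simp add: scalar_prod_def scalar_mat_def)
  finally show ?thesis by simp
qed

lemma matrix_unit_carrier [simp]: "matrix_unit m i j \<in> carrier_mat m m"
  by (simp add: matrix_unit_def)

lemma psd_mat_matrix_unit: "psd_mat m (matrix_unit m i i)"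
  by (rule psd_mat_diagonal) (auto simp: matrix_unit_def diagonal_mat_def less_eq_complex_def)

text \<open>This is X X* for the column X = (1, q).\<close>

lemma psd_mat_pencil:
  "psd_mat 2 (matrix_unit 2 0 0 + cnj q \<cdot>\<^sub>m matrix_unit 2 0 1 + q \<cdot>\<^sub>m matrix_unit 2 1 0
    + (q * cnj q) \<cdot>\<^sub>m matrix_unit 2 1 1)"
proof -
  define X where "X = mat 2 1 (\<lambda>(i, j). if i = 0 then 1 else q)"
  have X: "X \<in> carrier_mat 2 1"
    by (simp add: X_def)
  have "X * mat_adjoint X = matrix_unit 2 0 0 + cnj q \<cdot>\<^sub>m matrix_unit 2 0 1
      + q \<cdot>\<^sub>m matrix_unit 2 1 0 + (q * cnj q) \<cdot>\<^sub>m matrix_unit 2 1 1"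
    by (rule eq_matI) (auto simp: X_def matrix_unit_def scalar_prod_def)
  then show ?thesis
    using psd_mat_mult_adjoint[OF X] by simp
qed

text \<open>A compression: P deletes the first m coordinates, and P M P* is the block.\<close>

lemma psd_mat_lower_right_block:
  assumes psd: "psd_mat (m + n) M"
  shows "psd_mat n (mat n n (\<lambda>(i, j). M $$ (m + i, m + j)))"
proof -
  define P where "P = mat n (m + n) (\<lambda>(i, j). if j = m + i then 1 else 0 :: complex)"
  have P: "P \<in> carrier_mat n (m + n)" and M: "M \<in> carrier_mat (m + n) (m + n)"
    using psd by (simp_all add: P_def psd_mat_def)
  have PM: "(P * M) $$ (i, j) = M $$ (m + i, j)" if "i < n" "j < m + n" for i j
  proof -
    have "(P * M) $$ (i, j) = (\<Sum>k = 0..<m + n. P $$ (i, k) * M $$ (k, j))"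
      using that P M by (auto simp: scalar_prod_def intro!: sum.cong)
    also have "\<dots> = (\<Sum>k = 0..<m + n. if k = m + i then M $$ (k, j) else 0)"
      using that by (intro sum.cong) (auto simp: P_def)
    finally show ?thesis
      using that by simp
  qed
  have "P * M * mat_adjoint P = mat n n (\<lambda>(i, j). M $$ (m + i, m + j))"
  proof (rule eq_matI)
    fix i j
    assume "i < dim_row (mat n n (\<lambda>(i, j). M $$ (m + i, m + j)))"
      and "j < dim_col (mat n n (\<lambda>(i, j). M $$ (m + i, m + j)))"
    then have ij: "i < n" "j < n"
      by auto
    have "(P * M * mat_adjoint P) $$ (i, j)
        = (\<Sum>k = 0..<m + n. (P * M) $$ (i, k) * mat_adjoint P $$ (k, j))"
      using ij P M by (subst index_mult_mat(1)) (auto simp: scalar_prod_def intro!: sum.cong)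
    also have "\<dots> = (\<Sum>k = 0..<m + n. if k = m + j then M $$ (m + i, k) else 0)"
      using ij P by (intro sum.cong) (auto simp: PM simp del: index_mult_mat(1), auto simp: P_def)
    finally show "(P * M * mat_adjoint P) $$ (i, j) = mat n n (\<lambda>(i, j). M $$ (m + i, m + j)) $$ (i, j)"
      using ij by simp
  qed (use P in auto)
  then show ?thesis
    using psd_mat_congruence[OF P psd] by simp
qed

theorem proposition2p3:
  fixes n :: nat and \<phi> :: "complex mat \<Rightarrow> complex mat"
    and a x :: complex and B C T U Y Z :: "complex mat"
  assumes "n \<ge> 1"
    and "linear_mat_map 2 (n + 1) \<phi>"
    and "positive_mat_map 2 (n + 1) \<phi>"
    and "C \<in> carrier_mat 1 n" and "Y \<in> carrier_mat 1 n" and "Z \<in> carrier_mat 1 n"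
    and "B \<in> carrier_mat n n" and "T \<in> carrier_mat n n" and "U \<in> carrier_mat n n"
    and "choi_matrix \<phi> = four_block_mat
      (four_block_mat (scalar_mat a) C (mat_adjoint C) B)
      (four_block_mat (scalar_mat x) Y (mat_adjoint Z) T)
      (four_block_mat (scalar_mat (cnj x)) Z (mat_adjoint Y) (mat_adjoint T))
      (four_block_mat (0\<^sub>m 1 1) (0\<^sub>m 1 n) (0\<^sub>m n 1) U)"
  shows "loewner_le n (mat_abs Y + mat_abs Z) (csqrt a \<cdot>\<^sub>m psd_sqrt U)"
proof -
  note C = assms(4) and Y = assms(5) and Z = assms(6) and B = assms(7) and T = assms(8) and U = assms(9)
  let ?E = "matrix_unit 2"
  let ?F = "\<lambda>m R K N. four_block_mat (scalar_mat m) R (mat_adjoint K) N"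
  have \<phi>_carrier: "\<phi> X \<in> carrier_mat (n + 1) (n + 1)" if "X \<in> carrier_mat 2 2" for X
    using assms(2) that by (auto simp: linear_mat_map_def)
  have \<phi>_add: "\<phi> (X + X') = \<phi> X + \<phi> X'" if "X \<in> carrier_mat 2 2" "X' \<in> carrier_mat 2 2" for X X'
    using assms(2) that by (auto simp: linear_mat_map_def)
  have \<phi>_smult: "\<phi> (k \<cdot>\<^sub>m X) = k \<cdot>\<^sub>m \<phi> X" if "X \<in> carrier_mat 2 2" for k X
    using assms(2) that by (auto simp: linear_mat_map_def)
  have \<phi>_psd: "psd_mat (1 + n) (\<phi> X)" if "psd_mat 2 X" for X
    using assms(3) that by (simp add: positive_mat_map_def)
  have F_carrier: "?F m R K N \<in> carrier_mat (n + 1) (n + 1)" if "N \<in> carrier_mat n n" for m R K N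
    using four_block_carrier_mat[of "scalar_mat m" 1 1 N n n] that
    by (simp add: scalar_mat_def add.commute)
  \<comment> \<open>Gives the last Choi block the same shape as the other three, so that
    \<open>block_form\<close> evaluates all of them.\<close>
  have zero: "four_block_mat (0\<^sub>m 1 1) (0\<^sub>m 1 n) (0\<^sub>m n 1) U = ?F 0 (0\<^sub>m 1 n) (0\<^sub>m 1 n) U"
    by (intro cong_four_block_mat eq_matI) (auto simp: scalar_mat_def)
  note blocks = four_block_mat_inject[OF \<phi>_carrier[OF matrix_unit_carrier]
      \<phi>_carrier[OF matrix_unit_carrier] \<phi>_carrier[OF matrix_unit_carrier]
      \<phi>_carrier[OF matrix_unit_carrier] F_carrier[OF B] F_carrier[OF T]
      F_carrier[OF mat_adjoint_carrier[OF T]] F_carrier[OF U]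
      assms(10)[unfolded zero choi_matrix_def]]
  have a0: "0 \<le> a"
    using psd_mat_diag_nonneg[OF \<phi>_psd[OF psd_mat_matrix_unit[of 2 0]], of 0] B
    by (simp add: blocks scalar_mat_def)
  have "psd_mat (1 + n) (?F 0 (0\<^sub>m 1 n) (0\<^sub>m 1 n) U)"
    using \<phi>_psd[OF psd_mat_matrix_unit[of 2 1]] by (simp only: blocks)
  then have "psd_mat n (mat n n (\<lambda>(i, j). ?F 0 (0\<^sub>m 1 n) (0\<^sub>m 1 n) U $$ (1 + i, 1 + j)))"
    by (rule psd_mat_lower_right_block)
  also have "mat n n (\<lambda>(i, j). ?F 0 (0\<^sub>m 1 n) (0\<^sub>m 1 n) U $$ (1 + i, 1 + j)) = U"
    using U by (intro eq_matI) (auto simp: scalar_mat_def)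
  finally have psdU: "psd_mat n U" .
  have key: "(cmod ((Y *\<^sub>v v) $ 0) + cmod ((Z *\<^sub>v v) $ 0))\<^sup>2 \<le> Re a * Re ((U *\<^sub>v v) \<bullet>c v)"
    if v: "v \<in> carrier_vec n" for v
  proof (rule positive_form_bound)
    show "0 \<le> Re a"
      using a0 by (simp add: less_eq_complex_def)
    fix s q :: complex
    define w where "w = vec 1 (\<lambda>_. s) @\<^sub>v v"
    have w: "w \<in> carrier_vec (n + 1)"
      using append_carrier_vec[of "vec 1 (\<lambda>_. s)" 1 v n] v unfolding w_def by (simp add: add.commute)
    let ?f = "\<lambda>M. (M *\<^sub>v w) \<bullet>c w"
    have f_add: "?f (M + N) = ?f M + ?f N"
      if "M \<in> carrier_mat (n + 1) (n + 1)" "N \<in> carrier_mat (n + 1) (n + 1)" for M N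
      using that w by (simp add: add_mult_distrib_mat_vec cscalar_prod_left_add[of _ "n + 1"])
    have f_smult: "?f (k \<cdot>\<^sub>m M) = k * ?f M" if "M \<in> carrier_mat (n + 1) (n + 1)" for k M
      using that w by (simp add: smult_mat_mult_vec[OF that w])
    note form = block_form[OF _ _ _ v, of _ _ _ _ s, folded w_def]
    have "0 \<le> ?f (\<phi> (?E 0 0 + cnj q \<cdot>\<^sub>m ?E 0 1 + q \<cdot>\<^sub>m ?E 1 0 + (q * cnj q) \<cdot>\<^sub>m ?E 1 1))"
      using \<phi>_psd[OF psd_mat_pencil] w by (simp add: psd_mat_def)
    also have "\<dots> = ?f (\<phi> (?E 0 0)) + cnj q * ?f (\<phi> (?E 0 1)) + q * ?f (\<phi> (?E 1 0))
        + (q * cnj q) * ?f (\<phi> (?E 1 1))"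
      by (simp add: \<phi>_add \<phi>_smult f_add f_smult \<phi>_carrier del: One_nat_def)
    also have "?f (\<phi> (?E 0 0)) = a * complex_of_real ((cmod s)\<^sup>2) + cnj s * (C *\<^sub>v v) $ 0
        + s * cnj ((C *\<^sub>v v) $ 0) + (B *\<^sub>v v) \<bullet>c v"
      unfolding blocks by (rule form[OF C C B])
    also have "?f (\<phi> (?E 0 1)) = x * complex_of_real ((cmod s)\<^sup>2) + cnj s * (Y *\<^sub>v v) $ 0
        + s * cnj ((Z *\<^sub>v v) $ 0) + (T *\<^sub>v v) \<bullet>c v"
      unfolding blocks by (rule form[OF Y Z T])
    also have "?f (\<phi> (?E 1 0)) = cnj x * complex_of_real ((cmod s)\<^sup>2) + cnj s * (Z *\<^sub>v v) $ 0
        + s * cnj ((Y *\<^sub>v v) $ 0) + (mat_adjoint T *\<^sub>v v) \<bullet>c v"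
      unfolding blocks by (rule form[OF Z Y mat_adjoint_carrier[OF T]])
    also have "?f (\<phi> (?E 1 1)) = (U *\<^sub>v v) \<bullet>c v"
      unfolding blocks using form[OF zero_carrier_mat zero_carrier_mat U, of 0] v by simp
    also have "q * cnj q = complex_of_real ((cmod q)\<^sup>2)"
      by (rule complex_norm_square[symmetric])
    \<comment> \<open>Only the real part of the complex inequality is kept; the two conjugate terms
      with \<open>C\<close> merge into a doubled real part.\<close>
    finally show "0 \<le> Re a * (cmod s)\<^sup>2 + 2 * Re (cnj s * (C *\<^sub>v v) $ 0) + Re ((B *\<^sub>v v) \<bullet>c v)
        + Re (cnj q * (x * complex_of_real ((cmod s)\<^sup>2) + cnj s * (Y *\<^sub>v v) $ 0
          + s * cnj ((Z *\<^sub>v v) $ 0) + (T *\<^sub>v v) \<bullet>c v))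
        + Re (q * (cnj x * complex_of_real ((cmod s)\<^sup>2) + cnj s * (Z *\<^sub>v v) $ 0
          + s * cnj ((Y *\<^sub>v v) $ 0) + (mat_adjoint T *\<^sub>v v) \<bullet>c v))
        + (cmod q)\<^sup>2 * Re ((U *\<^sub>v v) \<bullet>c v)"
      unfolding less_eq_complex_def plus_complex.sel Re_complex_of_real
      by (simp add: algebra_simps del: index_mult_mat_vec of_real_power)
  qed
  \<comment> \<open>Since \<open>csqrt a\<close> is real and nonnegative, \<open>W\<close> is the
    positive root of a U, so the comparison can be made between squares.\<close>
  define W where "W = csqrt a \<cdot>\<^sub>m psd_sqrt U"
  have "0 \<le> csqrt a"
    using a0 by (simp add: less_eq_complex_def csqrt_of_real_nonneg)
  then have W: "psd_mat n W"
    unfolding W_def using psd_mat_smult psd_sqrt(1)[OF psdU] by blast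
  have "psd_sqrt U \<in> carrier_mat n n"
    using psd_sqrt(1)[OF psdU] by (simp add: psd_mat_def)
  then have "W * W = (csqrt a * csqrt a) \<cdot>\<^sub>m (psd_sqrt U * psd_sqrt U)"
    unfolding W_def
    by (intro eq_matI) (auto simp: mult_smult_assoc_mat[of _ n n _ n] mult_smult_distrib[of _ n n _ n])
  then have WW: "W * W = a \<cdot>\<^sub>m U"
    using psd_sqrt(2)[OF psdU] by (simp flip: power2_eq_square)
  have V: "psd_mat n (mat_abs Y + mat_abs Z)"
    using psd_mat_add[OF psd_mat_abs(1)[OF Y] psd_mat_abs(1)[OF Z]] .
  have abs_carrier: "mat_abs Y \<in> carrier_mat n n" "mat_abs Z \<in> carrier_mat n n"
    using psd_mat_abs(1)[OF Y] psd_mat_abs(1)[OF Z] by (auto simp: psd_mat_def)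
  have "psd_mat n (W - (mat_abs Y + mat_abs Z))"
  proof (rule psd_mat_diff_if_norm_le[OF V W])
    fix v :: "complex vec" assume v: "v \<in> carrier_vec n"
    \<comment> \<open>A row times a vector has a single entry, so the length is its modulus; this
      links \<open>key\<close> to lengths.\<close>
    have row: "vnorm (X *\<^sub>v v) = cmod ((X *\<^sub>v v) $ 0)" if "X \<in> carrier_mat 1 n" for X
      using that by (simp add: vnorm_def L2_set_def del: index_mult_mat_vec)
    have "vnorm ((mat_abs Y + mat_abs Z) *\<^sub>v v) \<le> vnorm (mat_abs Y *\<^sub>v v) + vnorm (mat_abs Z *\<^sub>v v)"
      using abs_carrier v vnorm_triangle[of "mat_abs Y *\<^sub>v v" n "mat_abs Z *\<^sub>v v"]
      by (simp add: add_mult_distrib_mat_vec)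
    also have "\<dots> = cmod ((Y *\<^sub>v v) $ 0) + cmod ((Z *\<^sub>v v) $ 0)"
      using vnorm_mat_abs[OF Y v] vnorm_mat_abs[OF Z v] row[OF Y] row[OF Z] by simp
    finally have "(vnorm ((mat_abs Y + mat_abs Z) *\<^sub>v v))\<^sup>2
        \<le> (cmod ((Y *\<^sub>v v) $ 0) + cmod ((Z *\<^sub>v v) $ 0))\<^sup>2"
      by (intro power_mono) auto
    also have "\<dots> \<le> Re a * Re ((U *\<^sub>v v) \<bullet>c v)"
      by (rule key[OF v])
    also have "\<dots> = Re (a * ((U *\<^sub>v v) \<bullet>c v))"
      using a0 by (simp add: less_eq_complex_def)
    also have "a * ((U *\<^sub>v v) \<bullet>c v) = (W *\<^sub>v v) \<bullet>c (W *\<^sub>v v)"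
      using W v U hermitian_cscalar_prod_self[of W n v]
      by (simp add: psd_mat_def WW smult_mat_mult_vec[OF U v])
    finally show "Re (((mat_abs Y + mat_abs Z) *\<^sub>v v) \<bullet>c ((mat_abs Y + mat_abs Z) *\<^sub>v v))
        \<le> Re ((W *\<^sub>v v) \<bullet>c (W *\<^sub>v v))"
      unfolding cscalar_prod_self[of "(mat_abs Y + mat_abs Z) *\<^sub>v v"] by simp
  qed
  then show ?thesis
    using V W unfolding loewner_le_def W_def psd_mat_def by blast
qed

end
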